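(* Let $G=(V,E)$ be a connected claw-free graph with clique number $\omega(G)=\omega\ge 5$. Then one of the following is true: (i) $G$ is the line graph $L(F)$ of a graph $F$ of maximum degree $\omega$; or (ii) there exists $v\in V$ with $\deg_{G^2}(v)\le 2\omega(\omega-1)-4$ such that $\deg_{G^2}(x)\le 2\omega(\omega-1)-3$ for all $x\in N_G(v)$.
   Context: A graph is claw-free if it has no induced $K_{1,3}$. The square $G^2$ of $G$ is the graph on $V$ in which two distinct vertices are adjacent iff they are at distance at most $2$ in $G$; $\deg_{G^2}(v)$ is the degree of $v$ in $G^2$; $N_G(v)$ is the open neighbourhood of $v$ in $G$. *)

theory Defs
  imports "Graph_Theory.Graph_Theory"
begin

text \<open>
  Finite simple graphs are the symmetric loop-free digraphs of the locale \<^locale>\<open>pair_graph\<close>.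
  Every undirected edge is represented by its two arcs, so the degree of a vertex is its
  \<^const>\<open>out_degree\<close>.
\<close>

definition claw_free :: "'a pair_pre_digraph \<Rightarrow> bool" where
  "claw_free G \<longleftrightarrow>
     \<not> (\<exists>H. induced_subgraph H (with_proj G) \<and> complete_bipartite_digraph 1 3 H)"

definition clique_number :: "'a pair_pre_digraph \<Rightarrow> nat" where
  "clique_number G = Max {n. \<exists>H. subgraph H (with_proj G) \<and> complete_digraph n H}"

definition graph_degree :: "'a pair_pre_digraph \<Rightarrow> 'a \<Rightarrow> nat" where
  "graph_degree G v = out_degree (with_proj G) v"

text \<open>Meaningful for a nonempty vertex set only.\<close>
definition max_degree :: "'a pair_pre_digraph \<Rightarrow> nat" where
  "max_degree G = Max (graph_degree G ` pverts G)"

definition open_neighbourhood :: "'a pair_pre_digraph \<Rightarrow> 'a \<Rightarrow> 'a set" where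
  "open_neighbourhood G v = {x. v \<rightarrow>\<^bsub>with_proj G\<^esub> x}"

text \<open>The distance is the minimum cost of a walk when every arc has weight 1.\<close>
definition graph_dist :: "'a pair_pre_digraph \<Rightarrow> 'a \<Rightarrow> 'a \<Rightarrow> ereal" where
  "graph_dist G u v = wf_digraph.\<mu> (with_proj G) (\<lambda>_. 1) u v"

definition graph_square :: "'a pair_pre_digraph \<Rightarrow> 'a pair_pre_digraph" where
  "graph_square G = \<lparr> pverts = pverts G,
     parcs = {(u, v). u \<in> pverts G \<and> v \<in> pverts G \<and> u \<noteq> v \<and> graph_dist G u v \<le> 2} \<rparr>"

definition undirected_edges :: "'a pair_pre_digraph \<Rightarrow> 'a set set" where
  "undirected_edges G = {{u, v} | u v. (u, v) \<in> parcs G}"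

definition line_graph :: "'a pair_pre_digraph \<Rightarrow> 'a set pair_pre_digraph" where
  "line_graph F = \<lparr> pverts = undirected_edges F,
     parcs = {(e, f). e \<in> undirected_edges F \<and> f \<in> undirected_edges F \<and> e \<noteq> f \<and> e \<inter> f \<noteq> {}} \<rparr>"

end

theory Submission
  imports Defs
begin

text \<open>
  Let \<open>M = 2\<omega>(\<omega> - 1)\<close>. For \<open>x \<in> N(v)\<close> the set \<open>N(x) - N[v]\<close> is a clique with at most \<open>\<omega> - 1\<close>
  vertices. If \<open>N(v)\<close> is not a union of two cliques, then its complement graph is triangle-free and
  not bipartite, and at most four vertices of \<open>N(v)\<close> already see every vertex at distance 2, so
  the square degree of \<open>v\<close> is at most \<open>M - 4\<close>. Otherwise \<open>v\<close> has at most \<open>2(\<omega> - 1)\<close> neighbours, and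
  square degree at least \<open>M - 3\<close> forces \<open>N(v)\<close> to consist of two cliques of size \<open>\<omega> - 1\<close> with no
  edges between them. If the square degree is even at least \<open>M - 2\<close>, then so little is lost that also
  the neighbourhood of each neighbour of \<open>v\<close> splits into two cliques joined by a matching only. When
  alternative (ii) fails, every vertex is of one of these two kinds, the local splittings fit
  together, and by Krausz' criterion they exhibit \<open>G\<close> as a line graph.
\<close>

section \<open>Square degrees in claw-free graphs\<close>

text \<open>Adjacency is a bare relation here, which keeps the combinatorics free of arcs;
  \<open>\<omega>\<close> enters through the upper bound \<open>clique_bound\<close>.\<close>

locale claw_free_graph =
  fixes V :: "'a set" and adj :: "'a \<Rightarrow> 'a \<Rightarrow> bool" and \<omega> :: nat
  assumes finite_V: "finite V"
    and adj_in_V: "adj x y \<Longrightarrow> x \<in> V"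
    and adj_sym: "adj x y \<Longrightarrow> adj y x"
    and adj_irrefl: "\<not> adj x x"
    and no_claw: "\<lbrakk>adj c x; adj c y; adj c z; x \<noteq> y; y \<noteq> z; x \<noteq> z\<rbrakk>
      \<Longrightarrow> adj x y \<or> adj y z \<or> adj x z"
    and clique_bound: "\<lbrakk>K \<subseteq> V; \<And>x y. \<lbrakk>x \<in> K; y \<in> K; x \<noteq> y\<rbrakk> \<Longrightarrow> adj x y\<rbrakk> \<Longrightarrow> card K \<le> \<omega>"
    and omega_ge: "5 \<le> \<omega>"
begin

section \<open>Cliques, outer neighbourhoods and the degree bound\<close>

definition clique :: "'a set \<Rightarrow> bool" where
  "clique K \<longleftrightarrow> K \<subseteq> V \<and> (\<forall>x\<in>K. \<forall>y\<in>K. x \<noteq> y \<longrightarrow> adj x y)"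

definition nbhd :: "'a \<Rightarrow> 'a set" where
  "nbhd v = {x. adj v x}"

definition outer :: "'a \<Rightarrow> 'a \<Rightarrow> 'a set" where
  "outer v x = {w. adj x w \<and> \<not> adj v w \<and> w \<noteq> v}"

definition second :: "'a \<Rightarrow> 'a set" where
  "second v = (\<Union>x\<in>nbhd v. outer v x)"

text \<open>\<open>second v\<close> collects the vertices at distance exactly 2, so this is the
  degree of \<open>v\<close> in the square, expressed by adjacency alone.\<close>

definition sqdeg :: "'a \<Rightarrow> nat" where
  "sqdeg v = card (nbhd v) + card (second v)"

text \<open>Equivalently, the complement of the graph on \<open>nbhd v\<close> is bipartite. A part
  may be empty; disjointness lets the cardinalities add up.\<close>

definition two_cliques :: "'a \<Rightarrow> bool" where
  "two_cliques v \<longleftrightarrow> (\<exists>A B. nbhd v = A \<union> B \<and> A \<inter> B = {} \<and> clique A \<and> clique B)"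

lemma adj_commute: "adj x y \<longleftrightarrow> adj y x"
  using adj_sym by blast

lemma adj_in_V': "adj x y \<Longrightarrow> y \<in> V"
  using adj_in_V adj_sym by blast

lemma in_nbhd [simp]: "x \<in> nbhd v \<longleftrightarrow> adj v x"
  by (simp add: nbhd_def)

lemma finite_adj [simp]: "finite {w. adj x w \<and> P w}"
  by (rule finite_subset[OF _ finite_V]) (auto dest: adj_in_V')

lemma finite_nbhd [simp]: "finite (nbhd v)"
  by (rule finite_subset[OF _ finite_V]) (auto dest: adj_in_V')

lemma finite_outer [simp]: "finite (outer v x)"
  by (simp add: outer_def)

lemma finite_second [simp]: "finite (second v)"
  by (simp add: second_def)

lemma clique_adj: "\<lbrakk>clique K; x \<in> K; y \<in> K; x \<noteq> y\<rbrakk> \<Longrightarrow> adj x y"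
  by (simp add: clique_def)

lemma card_clique: "clique K \<Longrightarrow> card K \<le> \<omega>"
  using clique_bound unfolding clique_def by blast

lemma finite_clique: "clique K \<Longrightarrow> finite K"
  unfolding clique_def using finite_V finite_subset by blast

text \<open>Adding \<open>v\<close> to \<open>K\<close> gives a larger clique. The empty
  \<open>K\<close> is treated apart because \<open>v\<close> might then lie outside
  \<open>V\<close>.\<close>

lemma card_clique_nbhd:
  assumes "clique K" "K \<subseteq> nbhd v"
  shows "card K \<le> \<omega> - 1"
proof (cases "K = {}")
  case False
  then have "v \<in> V" using assms adj_in_V by fastforce
  then have "clique (insert v K)"
    using assms adj_sym unfolding clique_def by (auto simp: subset_iff)
  then have "card (insert v K) \<le> \<omega>" by (rule card_clique)
  moreover have "v \<notin> K" using assms(2) adj_irrefl by auto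
  ultimately show ?thesis using finite_clique[OF assms(1)] by simp
qed simp

text \<open>Two non-adjacent outer neighbours of \<open>x\<close> would form a claw at
  \<open>x\<close> together with \<open>v\<close>.\<close>

lemma clique_outer: "adj v x \<Longrightarrow> clique (insert x (outer v x))"
  unfolding clique_def outer_def
  using no_claw[of x v] adj_in_V' adj_sym by auto

lemma card_outer:
  assumes "adj v x"
  shows "card (outer v x) \<le> \<omega> - 1"
proof (rule card_clique_nbhd)
  show "clique (outer v x)" using clique_outer[OF assms] unfolding clique_def by auto
  show "outer v x \<subseteq> nbhd x" by (auto simp: outer_def)
qed

lemma clique_non_nbrs:
  assumes "adj v y"
  shows "clique {u. adj v u \<and> \<not> adj y u \<and> u \<noteq> y}"
  unfolding clique_def
  using no_claw[of v y] adj_in_V' adj_sym assms by auto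

text \<open>A Ramsey-type count: every vertex of \<open>nbhd v\<close> outside a largest clique
  \<open>I\<close> misses some \<open>y\<close> in \<open>I\<close>, and the vertices missing a
  fixed \<open>y\<close> form a clique, since otherwise \<open>v\<close> would be the centre of a
  claw.\<close>

lemma card_nbhd_le: "card (nbhd v) \<le> \<omega> * (\<omega> - 1)"
proof -
  let ?P = "\<lambda>K. clique K \<and> K \<subseteq> nbhd v"
  have "?P {}" by (simp add: clique_def)
  moreover have "\<forall>K. ?P K \<longrightarrow> card K \<le> \<omega>" using card_clique by blast
  ultimately obtain I where I: "?P I" and max: "\<And>K. ?P K \<Longrightarrow> card K \<le> card I"
    using Lattices_Big.ex_has_greatest_nat[of ?P "{}" card "Suc \<omega>"] by (auto simp: less_Suc_eq_le)
  define Q where "Q y = {u. adj v u \<and> \<not> adj y u \<and> u \<noteq> y}" for y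
  have finI: "finite I" using I finite_clique by blast
  have "nbhd v \<subseteq> I \<union> (\<Union>y\<in>I. Q y)"
  proof
    fix u assume u: "u \<in> nbhd v"
    show "u \<in> I \<union> (\<Union>y\<in>I. Q y)"
    proof (rule ccontr)
      assume n: "u \<notin> I \<union> (\<Union>y\<in>I. Q y)"
      then have "?P (insert u I)"
        using u I adj_in_V' adj_sym unfolding clique_def Q_def by auto
      then have "card (insert u I) \<le> card I" by (rule max)
      then show False using n finI by simp
    qed
  qed
  then have "card (nbhd v) \<le> card (I \<union> (\<Union>y\<in>I. Q y))"
    by (intro card_mono) (auto simp: finI Q_def)
  also have "\<dots> \<le> card I + (\<Sum>y\<in>I. card (Q y))"
    using card_Un_le[of I "\<Union>y\<in>I. Q y"] card_UN_le[OF finI, of Q] by linarith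
  also have "(\<Sum>y\<in>I. card (Q y)) \<le> (\<Sum>y\<in>I. \<omega> - 1)"
    using I clique_non_nbrs unfolding Q_def
    by (intro sum_mono card_clique_nbhd) auto
  also have "(\<Sum>y\<in>I. \<omega> - 1) = card I * (\<omega> - 1)" by simp
  also have "card I + card I * (\<omega> - 1) = card I * \<omega>"
    using omega_ge by (cases \<omega>) auto
  also have "\<dots> \<le> (\<omega> - 1) * \<omega>" using I card_clique_nbhd by (intro mult_right_mono) auto
  finally show ?thesis by (simp add: mult.commute)
qed

text \<open>In the complement of \<open>G[N(v)]\<close>, a neighbour \<open>x\<close> of a vertex \<open>w\<close> at distance 2 from \<open>v\<close>
  is joined to an end of every edge that avoids \<open>N(w)\<close>.\<close>

lemma dominates_non_edge:
  assumes "adj v x" "adj v y" "adj v z" "y \<noteq> z" "\<not> adj y z"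
    and "w \<in> outer v x" "\<not> adj w y" "\<not> adj w z"
  shows "\<not> adj x y \<or> \<not> adj x z"
  using assms no_claw[of x w y z] unfolding outer_def by (auto simp: adj_commute)

section \<open>Neighbourhoods that are not a union of two cliques\<close>

text \<open>The complement graph \<open>h\<close> on \<open>nbhd v\<close> is triangle-free. If no
  pair covers \<open>second v\<close>, some \<open>w\<close> is missed by both ends of an edge
  \<open>y z\<close> of \<open>h\<close>. Adjacency to \<open>w\<close> splits \<open>nbhd v\<close>
  into \<open>S\<close> and \<open>T\<close>, and each vertex of \<open>S\<close> dominates all
  edges inside \<open>T\<close>; without a pentagon this produces a 2-colouring of \<open>h\<close>.
  Only consecutive pentagon vertices are required to differ: in a triangle-free graph a closed walk
  of length 5 is a 5-cycle anyway.\<close>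

lemma second_covered_by_pair_or_pentagon:
  assumes nb: "\<not> two_cliques v"
  shows "(\<exists>y z. adj v y \<and> adj v z \<and> second v \<subseteq> outer v y \<union> outer v z) \<or>
    (\<exists>a b c d e. adj v a \<and> adj v b \<and> adj v c \<and> adj v d \<and> adj v e \<and>
       a \<noteq> b \<and> b \<noteq> c \<and> c \<noteq> d \<and> d \<noteq> e \<and> e \<noteq> a \<and>
       \<not> adj a b \<and> \<not> adj b c \<and> \<not> adj c d \<and> \<not> adj d e \<and> \<not> adj e a)"
    (is "?pair \<or> ?pentagon")
proof (rule ccontr)
  assume contra: "\<not> (?pair \<or> ?pentagon)"
  define h where "h x y \<longleftrightarrow> adj v x \<and> adj v y \<and> x \<noteq> y \<and> \<not> adj x y" for x y
  have h_sym: "h x y \<Longrightarrow> h y x" for x y by (auto simp: h_def adj_commute)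
  have tri: "h x y \<Longrightarrow> h y z \<Longrightarrow> \<not> h x z" for x y z
    unfolding h_def using no_claw[of v x y z] by auto
  have pent: "h a b \<Longrightarrow> h b c \<Longrightarrow> h c d \<Longrightarrow> h d e \<Longrightarrow> h e a \<Longrightarrow> False" for a b c d e
    using contra unfolding h_def by blast
  \<comment> \<open>Independent sets of \<open>h\<close> are cliques of the graph, so any
    2-colouring of \<open>h\<close> contradicts \<open>nb\<close>.\<close>
  have two: False if "\<And>x. adj v x \<longleftrightarrow> x \<in> A \<or> x \<in> B" "A \<inter> B = {}"
    "\<And>x y. x \<in> A \<Longrightarrow> y \<in> A \<Longrightarrow> \<not> h x y" "\<And>x y. x \<in> B \<Longrightarrow> y \<in> B \<Longrightarrow> \<not> h x y" for A B
  proof -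
    have "clique A" "clique B" using that adj_in_V' unfolding clique_def h_def by blast+
    moreover have "nbhd v = A \<union> B" using that by auto
    ultimately show False using nb that(2) unfolding two_cliques_def by blast
  qed
  have "\<exists>y z. h y z"
  proof (rule ccontr)
    assume "\<nexists>y z. h y z"
    then show False using two[of "nbhd v" "{}"] by auto
  qed
  then obtain y z where yz: "h y z" by blast
  then have "\<not> second v \<subseteq> outer v y \<union> outer v z" using contra unfolding h_def by blast
  then obtain w where w: "w \<in> second v" "w \<notin> outer v y" "w \<notin> outer v z" by blast
  then have wv: "\<not> adj v w" "w \<noteq> v" by (auto simp: second_def outer_def)
  define S where "S = {x. adj v x \<and> adj x w}"
  define T where "T = {x. adj v x \<and> \<not> adj x w}"
  have yzT: "y \<in> T" "z \<in> T" using yz w wv unfolding T_def h_def outer_def by auto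
  have ST: "S \<inter> T = {}" "\<And>x. adj v x \<longleftrightarrow> x \<in> S \<or> x \<in> T" by (auto simp: S_def T_def)
  have dom: "h x t \<or> h x t'" if "x \<in> S" "t \<in> T" "t' \<in> T" "h t t'" for x t t'
  proof -
    have "x \<noteq> t" "x \<noteq> t'" using that ST by auto
    moreover have "\<not> adj x t \<or> \<not> adj x t'"
      using that wv dominates_non_edge[of v x t t' w] unfolding S_def T_def h_def outer_def
      by (auto simp: adj_commute)
    ultimately show ?thesis using that unfolding S_def T_def h_def by auto
  qed
  define Sy where "Sy = {x\<in>S. h x y}"
  define Sz where "Sz = {x\<in>S. h x z}"
  have S_split: "S = Sy \<union> Sz" using dom[OF _ yzT yz] by (auto simp: Sy_def Sz_def)
  have indep_Sy: "\<And>a b. a \<in> Sy \<Longrightarrow> b \<in> Sy \<Longrightarrow> \<not> h a b"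
    unfolding Sy_def using tri h_sym by blast
  have indep_Sz: "\<And>a b. a \<in> Sz \<Longrightarrow> b \<in> Sz \<Longrightarrow> \<not> h a b"
    unfolding Sz_def using tri h_sym by blast
  define P where "P = {t\<in>T. \<exists>x\<in>Sy. h x t}"
  define Q where "Q = {t\<in>T. \<exists>x\<in>Sz. h x t}"
  have S_ne: "S \<noteq> {}" using w(1) by (auto simp: S_def second_def outer_def)
  show False
  proof (cases "Sy = {} \<or> Sz = {}")
    case False
    then obtain x0 x1 where x01: "x0 \<in> Sy" "x1 \<in> Sz" by blast
    \<comment> \<open>A vertex \<open>t\<close> joined to both \<open>Sy\<close> and
      \<open>Sz\<close> closes the 5-cycle \<open>t x y z x'\<close>.\<close>
    have PQ: "P \<inter> Q = {}"
    proof (rule ccontr)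
      assume "P \<inter> Q \<noteq> {}"
      then obtain t x x' where "x \<in> Sy" "h x t" "x' \<in> Sz" "h x' t"
        unfolding P_def Q_def by blast
      then show False using pent[of t x y z x'] yz h_sym unfolding Sy_def Sz_def by blast
    qed
    \<comment> \<open>\<open>x0\<close> must dominate the edge, which puts an end in
      \<open>P\<close>; \<open>x1\<close> likewise puts an end in \<open>Q\<close>.\<close>
    have edge: "(t \<in> P \<and> t' \<in> Q) \<or> (t \<in> Q \<and> t' \<in> P)" if "t \<in> T" "t' \<in> T" "h t t'" for t t'
    proof -
      have "t \<in> P \<or> t' \<in> P" "t \<in> Q \<or> t' \<in> Q"
        using dom[of x0, OF _ that] dom[of x1, OF _ that] x01 that S_split
        unfolding P_def Q_def by blast+
      then show ?thesis using PQ by blast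
    qed
    show False
    proof (rule two[of "(Sz - Sy) \<union> P" "Sy \<union> (T - P)"])
      show "adj v x \<longleftrightarrow> x \<in> (Sz - Sy) \<union> P \<or> x \<in> Sy \<union> (T - P)" for x
        using ST(2) S_split unfolding P_def by blast
      show "((Sz - Sy) \<union> P) \<inter> (Sy \<union> (T - P)) = {}"
        using ST(1) S_split unfolding P_def by blast
      show "\<not> h a b" if "a \<in> (Sz - Sy) \<union> P" "b \<in> (Sz - Sy) \<union> P" for a b
      proof
        assume ab: "h a b"
        have "\<not> (a \<in> Sz \<and> b \<in> Sz)" using ab indep_Sz by blast
        moreover have "\<not> (a \<in> P \<and> b \<in> P)" using ab edge PQ unfolding P_def by blast
        moreover have "\<not> (a \<in> Sz \<and> b \<in> P)" "\<not> (a \<in> P \<and> b \<in> Sz)"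
          using ab PQ h_sym unfolding P_def Q_def by blast+
        ultimately show False using that by blast
      qed
      show "\<not> h a b" if "a \<in> Sy \<union> (T - P)" "b \<in> Sy \<union> (T - P)" for a b
      proof
        assume ab: "h a b"
        have "\<not> (a \<in> Sy \<and> b \<in> Sy)" using ab indep_Sy by blast
        moreover have "\<not> (a \<in> T - P \<and> b \<in> T - P)" using ab edge by blast
        moreover have "\<not> (a \<in> Sy \<and> b \<in> T - P)" "\<not> (a \<in> T - P \<and> b \<in> Sy)"
          using ab h_sym unfolding P_def by blast+
        ultimately show False using that by blast
      qed
    qed
  next
    case True
    define R where "R = {t\<in>T. \<exists>x\<in>S. h x t}"
    \<comment> \<open>Here \<open>u\<close> is \<open>y\<close> or \<open>z\<close>, whichever is
      joined in \<open>h\<close> to all of \<open>S\<close>; a common neighbour makes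
      \<open>S\<close> independent.\<close>
    obtain u where u: "\<And>x. x \<in> S \<Longrightarrow> h x u"
      using True S_split unfolding Sy_def Sz_def by blast
    have indep_S: "\<And>a b. a \<in> S \<Longrightarrow> b \<in> S \<Longrightarrow> \<not> h a b"
      using u tri h_sym by blast
    \<comment> \<open>An edge inside \<open>R\<close> would close a 5-cycle through
      \<open>u\<close>.\<close>
    have edge: "\<not> (t \<in> R \<and> t' \<in> R)" if "h t t'" for t t'
    proof
      assume "t \<in> R \<and> t' \<in> R"
      then obtain x x' where "x \<in> S" "h x t" "x' \<in> S" "h x' t'" unfolding R_def by blast
      then show False using pent[of u x t t' x'] that u h_sym by blast
    qed
    have edge': "t \<in> R \<or> t' \<in> R" if "t \<in> T" "t' \<in> T" "h t t'" for t t'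
      using dom[OF _ that] S_ne that unfolding R_def by blast
    show False
    proof (rule two[of R "S \<union> (T - R)"])
      show "adj v x \<longleftrightarrow> x \<in> R \<or> x \<in> S \<union> (T - R)" for x
        using ST(2) unfolding R_def by blast
      show "R \<inter> (S \<union> (T - R)) = {}" using ST(1) unfolding R_def by blast
      show "\<not> h a b" if "a \<in> R" "b \<in> R" for a b using that edge by blast
      show "\<not> h a b" if "a \<in> S \<union> (T - R)" "b \<in> S \<union> (T - R)" for a b
      proof
        assume ab: "h a b"
        have "\<not> (a \<in> S \<and> b \<in> S)" using ab indep_S by blast
        moreover have "\<not> (a \<in> T - R \<and> b \<in> T - R)" using ab edge' by blast
        moreover have "\<not> (a \<in> S \<and> b \<in> T - R)" "\<not> (a \<in> T - R \<and> b \<in> S)"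
          using ab h_sym unfolding R_def by blast+
        ultimately show False using that by blast
      qed
    qed
  qed
qed

text \<open>Suppose \<open>w\<close> is missed by \<open>a\<close>, \<open>b\<close>,
  \<open>c\<close>, \<open>d\<close>. If \<open>w\<close> is adjacent to \<open>e\<close>, then
  \<open>e\<close> dominates the complement edge \<open>b c\<close>, which creates a triangle in the
  complement. Otherwise a vertex \<open>x\<close> reaching \<open>w\<close> is joined in the
  complement to exactly one end of each edge of the 5-cycle, impossible on an odd cycle.\<close>

lemma second_covered_by_pentagon:
  assumes N: "adj v a" "adj v b" "adj v c" "adj v d" "adj v e"
    and ne: "a \<noteq> b" "b \<noteq> c" "c \<noteq> d" "d \<noteq> e" "e \<noteq> a"
    and non: "\<not> adj a b" "\<not> adj b c" "\<not> adj c d" "\<not> adj d e" "\<not> adj e a"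
  shows "second v \<subseteq> outer v a \<union> outer v b \<union> outer v c \<union> outer v d"
proof
  fix w assume w: "w \<in> second v"
  then obtain x where x: "adj v x" "w \<in> outer v x" by (auto simp: second_def)
  show "w \<in> outer v a \<union> outer v b \<union> outer v c \<union> outer v d"
  proof (rule ccontr)
    assume "w \<notin> outer v a \<union> outer v b \<union> outer v c \<union> outer v d"
    then have nw: "\<not> adj w a" "\<not> adj w b" "\<not> adj w c" "\<not> adj w d"
      using x unfolding outer_def by (auto simp: adj_commute)
    define h where "h x y \<longleftrightarrow> adj v x \<and> adj v y \<and> x \<noteq> y \<and> \<not> adj x y" for x y
    have tri: "h x y \<Longrightarrow> h y z \<Longrightarrow> \<not> h x z" for x y z
      unfolding h_def using no_claw[of v x y z] by auto
    have h_sym: "h x y \<Longrightarrow> h y x" for x y by (auto simp: h_def adj_commute)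
    have cyc: "h a b" "h b c" "h c d" "h d e" "h e a" using N ne non unfolding h_def by auto
    have dom: "h u t \<or> h u t'"
      if "adj v u" "w \<in> outer v u" "h t t'" "\<not> adj w t" "\<not> adj w t'" for u t t'
      using that dominates_non_edge[of v u t t' w] unfolding h_def outer_def
      by (auto simp: adj_commute)
    show False
    proof (cases "adj w e")
      case True
      then have "w \<in> outer v e" using x unfolding outer_def by (auto simp: adj_commute)
      from dom[OF N(5) this cyc(2) nw(2) nw(3)] show False
        using tri h_sym cyc by blast
    next
      case False
      have "h x a \<or> h x b" "h x b \<or> h x c" "h x c \<or> h x d" "h x d \<or> h x e" "h x e \<or> h x a"
        using dom[OF x] cyc nw False by blast+
      moreover have "\<not> (h x a \<and> h x b)" "\<not> (h x b \<and> h x c)" "\<not> (h x c \<and> h x d)"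
        "\<not> (h x d \<and> h x e)" "\<not> (h x e \<and> h x a)"
        using tri h_sym cyc by blast+
      ultimately show False by blast
    qed
  qed
qed

lemma card_second_le:
  assumes "second v \<subseteq> (\<Union>x\<in>X. outer v x)" "X \<subseteq> nbhd v"
  shows "card (second v) \<le> card X * (\<omega> - 1)"
proof -
  have "finite X" using assms(2) finite_subset finite_nbhd by blast
  have "card (second v) \<le> card (\<Union>x\<in>X. outer v x)"
    using assms(1) \<open>finite X\<close> by (intro card_mono) auto
  also have "\<dots> \<le> (\<Sum>x\<in>X. card (outer v x))" by (rule card_UN_le[OF \<open>finite X\<close>])
  also have "\<dots> \<le> (\<Sum>x\<in>X. \<omega> - 1)" using assms(2) card_outer by (intro sum_mono) auto
  finally show ?thesis by simp
qed

text \<open>Four outer sets suffice, so the square degree is at most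
  \<open>\<omega> * (\<omega> - 1) + 4 * (\<omega> - 1)\<close>. The claim then amounts to
  \<open>4 * \<omega> \<le> \<omega> * (\<omega> - 1)\<close>, which is where
  \<open>\<omega> \<ge> 5\<close> enters.\<close>

lemma sqdeg_not_two_cliques:
  assumes "\<not> two_cliques v"
  shows "sqdeg v + 4 \<le> 2 * \<omega> * (\<omega> - 1)"
proof -
  have "\<exists>X. X \<subseteq> nbhd v \<and> card X \<le> 4 \<and> second v \<subseteq> (\<Union>x\<in>X. outer v x)"
    using second_covered_by_pair_or_pentagon[OF assms]
  proof (elim disjE exE conjE)
    fix y z assume "adj v y" "adj v z" "second v \<subseteq> outer v y \<union> outer v z"
    then show ?thesis by (intro exI[of _ "{y, z}"]) (auto simp: card_insert_if)
  next
    fix a b c d e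
    assume "adj v a" "adj v b" "adj v c" "adj v d" "adj v e"
       "a \<noteq> b" "b \<noteq> c" "c \<noteq> d" "d \<noteq> e" "e \<noteq> a"
       "\<not> adj a b" "\<not> adj b c" "\<not> adj c d" "\<not> adj d e" "\<not> adj e a"
    then show ?thesis using second_covered_by_pentagon[of v a b c d e]
      by (intro exI[of _ "{a, b, c, d}"]) (auto simp: card_insert_if)
  qed
  then obtain X where X: "X \<subseteq> nbhd v" "card X \<le> 4" "second v \<subseteq> (\<Union>x\<in>X. outer v x)" by blast
  then have "card (second v) \<le> card X * (\<omega> - 1)" using card_second_le by blast
  also have "\<dots> \<le> 4 * (\<omega> - 1)" using X(2) by simp
  finally have "sqdeg v \<le> \<omega> * (\<omega> - 1) + 4 * (\<omega> - 1)"
    unfolding sqdeg_def using card_nbhd_le[of v] by linarith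
  moreover obtain k where "\<omega> = k + 5" using omega_ge le_Suc_ex by (metis add.commute)
  ultimately show ?thesis by (simp add: algebra_simps)
qed

section \<open>Vertices of large square degree\<close>

text \<open>\<open>mid\<close> and \<open>high\<close> negate the two degree bounds of alternative
  (ii), in additive form to avoid truncated subtraction.\<close>

definition mid :: "'a \<Rightarrow> bool" where
  "mid v \<longleftrightarrow> 2 * \<omega> * (\<omega> - 1) \<le> sqdeg v + 3"

definition high :: "'a \<Rightarrow> bool" where
  "high v \<longleftrightarrow> 2 * \<omega> * (\<omega> - 1) \<le> sqdeg v + 2"

lemma high_imp_mid: "high v \<Longrightarrow> mid v"
  by (simp add: high_def mid_def)

lemma second_sub_outer: "second v \<subseteq> (\<Union>x\<in>nbhd v. outer v x)"
  by (simp add: second_def)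

text \<open>Any deviation from two full cliques without cross edges lowers the bound on the square
  degree by at least \<open>\<omega> - 1 \<ge> 4\<close>, while \<open>mid\<close> tolerates a loss
  of 3.\<close>

lemma mid_nbhd_split:
  assumes "mid v"
  obtains A B where "nbhd v = A \<union> B" "A \<inter> B = {}" "clique A" "clique B"
    "card A = \<omega> - 1" "card B = \<omega> - 1" "\<And>a b. a \<in> A \<Longrightarrow> b \<in> B \<Longrightarrow> \<not> adj a b"
proof -
  obtain k where k: "\<omega> = k + 5" using omega_ge le_Suc_ex by (metis add.commute)
  have "two_cliques v" using sqdeg_not_two_cliques[of v] assms unfolding mid_def by linarith
  then obtain A B where AB: "nbhd v = A \<union> B" "A \<inter> B = {}" "clique A" "clique B"
    unfolding two_cliques_def by blast
  have le: "card A \<le> \<omega> - 1" "card B \<le> \<omega> - 1" using AB(1,3,4) card_clique_nbhd by blast+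
  have card_N: "card (nbhd v) = card A + card B"
    using AB finite_clique by (simp add: card_Un_disjoint)
  \<comment> \<open>With at most \<open>2 * \<omega> - 3\<close> neighbours the square degree is at
    most \<open>\<omega> * (2 * \<omega> - 3)\<close>, a loss of \<open>\<omega>\<close>.\<close>
  have "2 * (\<omega> - 1) \<le> card (nbhd v)"
  proof (rule ccontr)
    assume "\<not> 2 * (\<omega> - 1) \<le> card (nbhd v)"
    then have n: "card (nbhd v) \<le> 2 * \<omega> - 3" by simp
    have "sqdeg v \<le> card (nbhd v) + card (nbhd v) * (\<omega> - 1)"
      unfolding sqdeg_def using card_second_le[OF second_sub_outer] by simp
    also have "\<dots> \<le> (2 * \<omega> - 3) + (2 * \<omega> - 3) * (\<omega> - 1)"
      using n by (intro add_mono mult_right_mono) auto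
    finally show False using assms k unfolding mid_def by (simp add: algebra_simps)
  qed
  then have eq: "card A = \<omega> - 1" "card B = \<omega> - 1" using le card_N by auto
  have "\<not> adj a b" if a: "a \<in> A" and b: "b \<in> B" for a b
  proof
    assume ab: "adj a b"
    have va: "adj v a" "adj v b" using AB(1) that by (auto simp flip: in_nbhd)
    have "\<exists>a'\<in>A. \<not> adj a' b"
    proof (rule ccontr)
      assume "\<not> (\<exists>a'\<in>A. \<not> adj a' b)"
      then have "clique (insert b A)"
        using AB b unfolding clique_def by (auto simp: adj_commute)
      moreover have "insert b A \<subseteq> nbhd v" using AB b by auto
      ultimately have "card (insert b A) \<le> \<omega> - 1" using card_clique_nbhd by blast
      moreover have "b \<notin> A" using AB b by blast
      ultimately show False using eq finite_clique[OF AB(3)] k by simp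
    qed
    then obtain a' where a': "a' \<in> A" "\<not> adj a' b" by blast
    then have aa': "a \<noteq> a'" "adj a a'" "adj v a'" "b \<noteq> a'" "b \<noteq> a"
      using ab AB a b unfolding clique_def by (auto simp flip: in_nbhd)
    \<comment> \<open>The absence of a claw at \<open>a\<close> on \<open>w\<close>,
      \<open>b\<close>, \<open>a'\<close> makes \<open>outer v a\<close> redundant, which saves one
      outer set of up to \<open>\<omega> - 1\<close> vertices.\<close>
    have cover: "second v \<subseteq> (\<Union>x\<in>nbhd v - {a}. outer v x)"
    proof
      fix w assume "w \<in> second v"
      then obtain x where x: "adj v x" "w \<in> outer v x" by (auto simp: second_def)
      show "w \<in> (\<Union>x\<in>nbhd v - {a}. outer v x)"
      proof (cases "x = a")
        case False
        then show ?thesis using x by auto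
      next
        case True
        have "w \<noteq> b" "w \<noteq> a'" using x va aa' unfolding outer_def by auto
        then have "adj w b \<or> adj w a'"
          using True x no_claw[of a w b a'] ab aa' a' va unfolding outer_def by (auto simp: adj_commute)
        then have "w \<in> outer v b \<or> w \<in> outer v a'"
          using x unfolding outer_def by (auto simp: adj_commute)
        then show ?thesis using va aa' by auto
      qed
    qed
    have "card (second v) \<le> card (nbhd v - {a}) * (\<omega> - 1)"
      using card_second_le[OF cover] by auto
    also have "card (nbhd v - {a}) = 2 * \<omega> - 3"
      using va card_N eq k by simp
    finally show False
      using assms card_N eq k unfolding mid_def sqdeg_def by (simp add: algebra_simps)
  qed
  then show ?thesis using that AB eq by blast
qed

text \<open>When \<open>v\<close> is \<open>mid\<close>, this is the one of the two cliques at
  \<open>v\<close> that contains \<open>x\<close>.\<close>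

definition side :: "'a \<Rightarrow> 'a \<Rightarrow> 'a set" where
  "side v x = {y. adj v y \<and> (y = x \<or> adj x y)}"

lemma mid_side:
  assumes "mid v" "adj v x"
  shows "clique (side v x)" "card (side v x) = \<omega> - 1"
proof -
  obtain A B where AB: "nbhd v = A \<union> B" "A \<inter> B = {}" "clique A" "clique B"
    "card A = \<omega> - 1" "card B = \<omega> - 1" "\<And>a b. a \<in> A \<Longrightarrow> b \<in> B \<Longrightarrow> \<not> adj a b"
    using mid_nbhd_split[OF assms(1)] by blast
  have N: "adj v y \<longleftrightarrow> y \<in> A \<or> y \<in> B" for y using AB(1) by (auto simp flip: in_nbhd)
  have "side v x = A \<or> side v x = B"
  proof (cases "x \<in> A")
    case True
    then have "side v x = A"
      using AB(3,7) N unfolding side_def clique_def by (auto simp: subset_iff)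
    then show ?thesis ..
  next
    case False
    then have "x \<in> B" using N assms by blast
    then have "side v x = B"
      using AB(4,7) N adj_sym[of x] unfolding side_def clique_def by (auto simp: subset_iff)
    then show ?thesis ..
  qed
  then show "clique (side v x)" "card (side v x) = \<omega> - 1" using AB by auto
qed

text \<open>The neighbourhood of a \<open>mid\<close> vertex is a disjoint union of cliques, so it
  has no induced path on three vertices. An induced path in \<open>nbhd v\<close> thus serves to
  refute \<open>mid v\<close>.\<close>

lemma mid_adj_trans:
  assumes "mid v" "adj v x" "adj v y" "adj v z" "adj x y" "adj y z" "x \<noteq> z"
  shows "adj x z"
proof -
  have "x \<in> side v y" "z \<in> side v y" using assms adj_sym unfolding side_def by auto
  then show ?thesis using mid_side(1)[OF assms(1,3)] assms(7) unfolding clique_def by blast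
qed

lemma mid_card_nbhd: "mid v \<Longrightarrow> card (nbhd v) = 2 * (\<omega> - 1)"
  by (erule mid_nbhd_split) (simp add: card_Un_disjoint finite_clique)

section \<open>Defects at a high vertex\<close>

definition common :: "'a \<Rightarrow> 'a \<Rightarrow> 'a set" where
  "common v w = {x. adj v x \<and> adj x w}"

lemma finite_common [simp]: "finite (common v w)"
  by (simp add: common_def)

text \<open>The square degree of \<open>v\<close> falls short of the maximum by a sum of non-negative defects:
  one for each neighbour with fewer than \<open>\<omega> - 1\<close> outer neighbours, and one for each vertex at
  distance 2 that is reached through more than one neighbour.\<close>

lemma high_defect:
  assumes "high v" "adj v x" "Z \<subseteq> second v"
  shows "(\<omega> - 1 - card (outer v x)) + (\<Sum>w\<in>Z. card (common v w) - 1) \<le> 2"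
proof -
  \<comment> \<open>Double counting of the adjacent pairs between \<open>nbhd v\<close> and
    \<open>second v\<close>.\<close>
  have count: "(\<Sum>y\<in>nbhd v. card (outer v y)) = (\<Sum>w\<in>second v. card (common v w))"
  proof -
    have "(\<Sum>y\<in>nbhd v. card (outer v y)) = (\<Sum>y\<in>nbhd v. \<Sum>w\<in>{w\<in>second v. adj y w}. 1)"
      by (intro sum.cong refl) (auto simp: outer_def second_def intro!: arg_cong[where f = card])
    also have "\<dots> = (\<Sum>w\<in>second v. \<Sum>y\<in>{y\<in>nbhd v. adj y w}. 1)"
      by (rule sum.swap_restrict) auto
    also have "\<dots> = (\<Sum>w\<in>second v. card (common v w))"
      by (simp add: common_def)
    finally show ?thesis .
  qed
  have pos: "card (common v w) \<ge> 1" if "w \<in> second v" for w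
  proof -
    have "common v w \<noteq> {}" using that by (auto simp: common_def second_def outer_def)
    then show ?thesis by (simp add: Suc_le_eq card_gt_0_iff)
  qed
  \<comment> \<open>Each truncated difference is exact, by \<open>card_outer\<close> here and by
    \<open>pos\<close> for the multiplicities below.\<close>
  have "(\<Sum>y\<in>nbhd v. \<omega> - 1 - card (outer v y)) + (\<Sum>y\<in>nbhd v. card (outer v y))
      = (\<Sum>y\<in>nbhd v. \<omega> - 1)"
    unfolding sum.distrib[symmetric] using card_outer by (intro sum.cong refl le_add_diff_inverse2) auto
  moreover have "(\<Sum>y\<in>nbhd v. \<omega> - 1) = 2 * (\<omega> - 1) * (\<omega> - 1)"
    using mid_card_nbhd high_imp_mid assms(1) by simp
  moreover have "(\<Sum>w\<in>second v. card (common v w) - 1) + (\<Sum>w\<in>second v. 1)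
      = (\<Sum>w\<in>second v. card (common v w))"
    unfolding sum.distrib[symmetric] using pos by (intro sum.cong refl le_add_diff_inverse2) auto
  moreover have "(\<Sum>w\<in>second v. 1) = card (second v)" by simp
  moreover have "2 * \<omega> * (\<omega> - 1) \<le> 2 * (\<omega> - 1) + card (second v) + 2"
    using assms(1) mid_card_nbhd[OF high_imp_mid[OF assms(1)]] unfolding high_def sqdeg_def by simp
  moreover have "2 * \<omega> * (\<omega> - 1) = 2 * (\<omega> - 1) + 2 * (\<omega> - 1) * (\<omega> - 1)"
    using omega_ge by (cases \<omega>) (auto simp: algebra_simps)
  ultimately have "(\<Sum>y\<in>nbhd v. \<omega> - 1 - card (outer v y)) + (\<Sum>w\<in>second v. card (common v w) - 1) \<le> 2"
    using count by linarith
  moreover have "\<omega> - 1 - card (outer v x) \<le> (\<Sum>y\<in>nbhd v. \<omega> - 1 - card (outer v y))"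
    using assms(2) by (intro member_le_sum) auto
  moreover have "(\<Sum>w\<in>Z. card (common v w) - 1) \<le> (\<Sum>w\<in>second v. card (common v w) - 1)"
    using assms(3) by (intro sum_mono2) auto
  ultimately show ?thesis by linarith
qed

lemma card_common_ge_2:
  assumes "adj v x" "adj v y" "x \<noteq> y" "adj x w" "adj y w"
  shows "2 \<le> card (common v w)"
proof -
  have "card {x, y} \<le> card (common v w)"
    using assms by (intro card_mono) (auto simp: common_def)
  then show ?thesis using assms by simp
qed

lemma card_common_ge_3:
  assumes "adj v x" "adj v y" "adj v z" "x \<noteq> y" "y \<noteq> z" "x \<noteq> z" "adj x w" "adj y w" "adj z w"
  shows "3 \<le> card (common v w)"
proof -
  have "card {x, y, z} \<le> card (common v w)"
    using assms by (intro card_mono) (auto simp: common_def)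
  then show ?thesis using assms by simp
qed

lemma outer_sub_second: "adj v x \<Longrightarrow> outer v x \<subseteq> second v"
  by (auto simp: second_def)

lemma in_outer: "w \<in> outer v x \<longleftrightarrow> adj x w \<and> \<not> adj v w \<and> w \<noteq> v"
  by (simp add: outer_def)

lemma adj_outer: "\<lbrakk>adj v x; w \<in> outer v x; w' \<in> outer v x; w \<noteq> w'\<rbrakk> \<Longrightarrow> adj w w'"
  using clique_outer unfolding clique_def by blast

text \<open>Three neighbours reaching \<open>w\<close> use up the whole defect 2. So all outer sets
  are full and every other vertex of \<open>second v\<close> is reached once. The absence of a claw
  at \<open>w\<close> containing \<open>y\<close> then merges \<open>outer v x\<close> and
  \<open>outer v z\<close>, which share only \<open>w\<close>, into a clique of
  \<open>2 * \<omega> - 3 > \<omega>\<close> vertices.\<close>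

lemma high_no_triple:
  assumes "high v" "adj v x" "adj v y" "adj v z" "x \<noteq> y" "y \<noteq> z" "x \<noteq> z"
    and w: "\<not> adj v w" "w \<noteq> v" "adj x w" "adj y w" "adj z w"
  shows False
proof -
  have wx: "w \<in> outer v x" and wz: "w \<in> outer v z" using w by (auto simp: in_outer)
  have wS: "w \<in> second v" using wx assms outer_sub_second by blast
  have c3: "3 \<le> card (common v w)" using card_common_ge_3 assms by blast
  have full: "card (outer v u) = \<omega> - 1" if "adj v u" for u
    using high_defect[OF assms(1) that, of "{w}"] wS c3 card_outer[OF that] by simp
  have single: "card (common v w') \<le> 1" if "w' \<in> second v" "w' \<noteq> w" for w'
    using high_defect[OF assms(1,2), of "{w, w'}"] wS c3 that by simp
  have adj13: "w1 \<noteq> w3 \<and> adj w1 w3"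
    if "w1 \<in> outer v x" "w1 \<noteq> w" "w3 \<in> outer v z" "w3 \<noteq> w" for w1 w3
  proof -
    have s: "card (common v w1) \<le> 1" "card (common v w3) \<le> 1"
      using single that outer_sub_second assms by blast+
    have n1: "\<not> adj y w1" "\<not> adj z w1"
      using s(1) that assms card_common_ge_2[of v x y w1] card_common_ge_2[of v x z w1]
      by (auto simp: in_outer)
    have n3: "\<not> adj y w3"
      using s(2) that assms card_common_ge_2[of v y z w3] by (auto simp: in_outer)
    have "w1 \<noteq> w3" using n1 that by (auto simp: in_outer)
    moreover have "adj w w1" "adj w w3"
      using adj_outer wx wz that assms by blast+
    moreover have "y \<noteq> w1" "y \<noteq> w3" using that assms by (auto simp: in_outer)
    ultimately show ?thesis
      using no_claw[of w y w1 w3] n1 n3 w by (auto simp: adj_commute)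
  qed
  have "clique (outer v x \<union> outer v z)"
    unfolding clique_def
  proof (intro conjI ballI impI subsetI)
    show "u \<in> V" if "u \<in> outer v x \<union> outer v z" for u
      using that adj_in_V' by (auto simp: in_outer)
    show "adj a b" if "a \<in> outer v x \<union> outer v z" "b \<in> outer v x \<union> outer v z" "a \<noteq> b" for a b
      using that adj13 adj_sym adj_outer assms(2,4) wx wz by blast
  qed
  then have "card (outer v x \<union> outer v z) \<le> \<omega>" by (rule card_clique)
  moreover have "outer v x \<inter> outer v z = {w}" using adj13 wx wz by blast
  then have "card (outer v x) + card (outer v z) = card (outer v x \<union> outer v z) + 1"
    using card_Un_Int[of "outer v x" "outer v z"] by simp
  ultimately show False using full assms omega_ge by simp
qed

end

section \<open>Graphs violating the second alternative\<close>

text \<open>The added assumption denies alternative (ii) at each vertex \<open>y\<close>.\<close>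

locale dense_claw_free_graph = claw_free_graph +
  assumes mid_or_high_nbr: "y \<in> V \<Longrightarrow> mid y \<or> (\<exists>u. adj y u \<and> high u)"
begin

text \<open>The vertices \<open>w\<close> and \<open>w'\<close> use up the defect 2, which fixes the
  structure around \<open>x\<close> and \<open>t\<close>. Then \<open>w\<close> is not
  \<open>mid\<close>, so it has a \<open>high\<close> neighbour \<open>u\<close>, and every position
  of \<open>u\<close> is excluded.\<close>

lemma high_no_double:
  assumes v: "high v" "adj v x" "adj v t" "adj x t"
    and w: "w \<in> outer v x" "w \<in> outer v t" and w': "w' \<in> outer v x" "w' \<in> outer v t"
    and ne: "w \<noteq> w'"
  shows False
proof -
  have xt: "x \<noteq> t" using v adj_irrefl by blast
  have S: "w \<in> second v" "w' \<in> second v" using w w' v outer_sub_second by blast+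
  have A: "adj x w" "adj t w" "adj x w'" "adj t w'" "\<not> adj v w" "\<not> adj v w'" "w \<noteq> v" "w' \<noteq> v"
    using w w' by (auto simp: in_outer)
  have c2: "2 \<le> card (common v w)" "2 \<le> card (common v w')"
    using A v xt card_common_ge_2[of v x t] by blast+
  have full: "card (outer v x) = \<omega> - 1"
    using high_defect[OF v(1,2), of "{w, w'}"] S c2 ne card_outer[OF v(2)] by simp
  have only: "a = x \<or> a = t" if "adj v a" "adj a w" for a
  proof (rule ccontr)
    assume "\<not> (a = x \<or> a = t)"
    then have "3 \<le> card (common v w)" using that v xt A card_common_ge_3[of v x t a w] by auto
    then show False using high_defect[OF v(1,2), of "{w, w'}"] S c2 ne by simp
  qed
  have single: "card (common v b) \<le> 1" if "b \<in> second v" "b \<noteq> w" "b \<noteq> w'" for b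
    using high_defect[OF v(1,2), of "{w, w', b}"] S c2 ne that by simp
  have single_x: "\<not> adj t b" if "b \<in> outer v x" "b \<noteq> w" "b \<noteq> w'" for b
    using single[of b] card_common_ge_2[of v x t b] that v xt outer_sub_second[of v x]
    by (auto simp: in_outer)
  have single_t: "\<not> adj x b" if "b \<in> outer v t" "b \<noteq> w" "b \<noteq> w'" for b
    using single[of b] card_common_ge_2[of v x t b] that v xt outer_sub_second[of v t]
    by (auto simp: in_outer)
  \<comment> \<open>\<open>outer v x\<close> is full, so at least
    \<open>\<omega> - 3 \<ge> 2\<close> further vertices remain.\<close>
  have "2 \<le> card (outer v x - {w, w'})"
    using full w w' ne omega_ge by (simp add: card_Diff_subset)
  then obtain B where "B \<subseteq> outer v x - {w, w'}" "card B = 2"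
    by (meson obtain_subset_with_card_n)
  then obtain b c where bc: "b \<in> outer v x" "c \<in> outer v x" "b \<noteq> c"
    "b \<noteq> w" "b \<noteq> w'" "c \<noteq> w" "c \<noteq> w'"
    by (auto simp: card_2_iff)
  have bcA: "adj w b" "adj w c" "adj w' b" "adj b c" "adj x b" "adj x c" "adj w w'"
    using bc ne adj_outer[OF v(2) w(1) bc(1)] adj_outer[OF v(2) w(1) bc(2)]
      adj_outer[OF v(2) w'(1) bc(1)] adj_outer[OF v(2) bc(1,2)] adj_outer[OF v(2) w(1) w'(1)]
    by (auto simp: in_outer)
  note sym = A(1-4)[THEN adj_sym] bcA[THEN adj_sym] v(2-4)[THEN adj_sym]
  have tb: "\<not> adj t b" "\<not> adj t c" "t \<noteq> b" "t \<noteq> c"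
    using single_x bc v by (auto simp: in_outer)
  \<comment> \<open>The induced path \<open>t x b\<close> lies in the neighbourhood of
    \<open>w\<close>. Similar paths rule out \<open>w'\<close>, \<open>x\<close> and
    \<open>t\<close> as values of \<open>u\<close>.\<close>
  have "\<not> mid w"
    using mid_adj_trans[of w t x b] A bcA tb v sym by metis
  moreover have "w \<in> V" using A adj_in_V' by blast
  ultimately obtain u where u: "adj w u" "high u" using mid_or_high_nbr by blast
  have mu: "mid u" using u high_imp_mid by blast
  have "u \<noteq> w'" using mid_adj_trans[of u t x b] mu A bcA tb v sym by metis
  have "u \<noteq> x" using mid_adj_trans[of u v t w] mu A v sym by metis
  have "u \<noteq> t" using mid_adj_trans[of u v x w] mu A v sym by metis
  have "u \<noteq> w" using u adj_irrefl by blast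
  have "u \<noteq> v" using adj_sym[OF u(1)] A by blast
  \<comment> \<open>Otherwise \<open>t\<close> is at distance 2 from the \<open>high\<close> vertex
    \<open>u\<close> and is reached through \<open>x\<close>, \<open>w\<close> and
    \<open>w'\<close>.\<close>
  have "u \<notin> outer v x"
  proof
    assume ux: "u \<in> outer v x"
    have "\<not> adj t u" using ux single_x \<open>u \<noteq> w\<close> \<open>u \<noteq> w'\<close> by blast
    moreover have "adj u x" "adj u w'"
      using ux \<open>u \<noteq> w'\<close> adj_outer[OF v(2) ux w'(1)] adj_sym[of x u] by (auto simp: in_outer)
    moreover have "x \<noteq> w" "x \<noteq> w'" using A v by blast+
    ultimately show False
      using high_no_triple[of u x w w' t] u A v ne \<open>u \<noteq> t\<close> by (auto simp: adj_commute)
  qed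
  moreover have "u \<notin> outer v t"
  proof
    assume ut: "u \<in> outer v t"
    have "\<not> adj x u" using ut single_t \<open>u \<noteq> w\<close> \<open>u \<noteq> w'\<close> by blast
    moreover have "adj u t" "adj u w'"
      using ut \<open>u \<noteq> w'\<close> adj_outer[OF v(3) ut w'(2)] adj_sym[of t u] by (auto simp: in_outer)
    moreover have "t \<noteq> w" "t \<noteq> w'" using A v by blast+
    ultimately show False
      using high_no_triple[of u t w w' x] u A v ne \<open>u \<noteq> x\<close> by (auto simp: adj_commute)
  qed
  moreover have "\<not> adj v u"
    using only[of u] adj_sym[OF u(1)] \<open>u \<noteq> x\<close> \<open>u \<noteq> t\<close> by blast
  ultimately have nu: "\<not> adj x u" "\<not> adj t u" using \<open>u \<noteq> v\<close> by (auto simp: in_outer)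
  \<comment> \<open>The absence of claws at \<open>w\<close> containing \<open>u\<close> and
    \<open>t\<close> joins \<open>u\<close> to \<open>b\<close> and \<open>c\<close>; then
    \<open>x\<close> is reached from \<open>u\<close> through \<open>w\<close>, \<open>b\<close> and
    \<open>c\<close>.\<close>
  have "u \<noteq> b" "u \<noteq> c" using nu bcA by blast+
  then have "adj u b" "adj u c"
    using no_claw[of w u b t] no_claw[of w u c t] u A bcA tb nu \<open>u \<noteq> t\<close>
    by (auto simp: adj_commute)
  then show False
    using high_no_triple[of u w b c x] u A bcA bc nu \<open>u \<noteq> x\<close> by (auto simp: adj_commute)
qed

text \<open>Cross edges between the two cliques at \<open>y\<close> come from triangles of the root graph, which is
  why they may form a matching. The last clause rules out that a cross triangle is mistaken for one
  of the two cliques when \<open>\<omega> = 5\<close>.\<close>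

definition krausz_pair :: "'a \<Rightarrow> 'a set \<Rightarrow> 'a set \<Rightarrow> bool" where
  "krausz_pair y P Q \<longleftrightarrow> clique P \<and> clique Q \<and> P \<union> Q = insert y (nbhd y) \<and> P \<inter> Q = {y} \<and>
     card P = \<omega> \<and> 3 \<le> card Q \<and>
     (\<forall>a\<in>P - {y}. \<forall>b\<in>Q - {y}. \<forall>b'\<in>Q - {y}. adj a b \<longrightarrow> adj a b' \<longrightarrow> b = b') \<and>
     (\<forall>b\<in>Q - {y}. \<forall>a\<in>P - {y}. \<forall>a'\<in>P - {y}. adj a b \<longrightarrow> adj a' b \<longrightarrow> a = a') \<and>
     (4 \<le> card Q \<or> (\<forall>a\<in>P - {y}. \<forall>b\<in>Q - {y}. \<not> adj a b))"

section \<open>Existence of the local splittings\<close>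

lemma krausz_pair_mid:
  assumes "mid y" "y \<in> V"
  shows "\<exists>P Q. krausz_pair y P Q"
proof -
  obtain A B where AB: "nbhd y = A \<union> B" "A \<inter> B = {}" "clique A" "clique B"
    "card A = \<omega> - 1" "card B = \<omega> - 1" "\<And>a b. a \<in> A \<Longrightarrow> b \<in> B \<Longrightarrow> \<not> adj a b"
    using mid_nbhd_split[OF assms(1)] by blast
  have N: "adj y z \<longleftrightarrow> z \<in> A \<or> z \<in> B" for z using AB(1) by (auto simp flip: in_nbhd)
  have "y \<notin> A" "y \<notin> B" using N adj_irrefl by blast+
  moreover have "clique (insert y A)" "clique (insert y B)"
    using AB(3,4) assms(2) N unfolding clique_def by (auto simp: adj_commute)
  ultimately have "krausz_pair y (insert y A) (insert y B)"
    unfolding krausz_pair_def using AB omega_ge finite_clique[OF AB(3)] finite_clique[OF AB(4)] by auto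
  then show ?thesis by blast
qed

text \<open>The clique at \<open>u\<close> through \<open>y\<close>, enlarged by \<open>u\<close>,
  is the full clique at \<open>y\<close>; the remaining neighbours of \<open>y\<close> are its outer
  ones. The matching conditions are \<open>high_no_double\<close> and
  \<open>high_no_triple\<close>.\<close>

lemma krausz_pair_high_nbr:
  assumes u: "high u" "adj u y"
  shows "krausz_pair y (insert u (side u y)) (insert y (outer u y))"
proof -
  let ?P = "insert u (side u y)" and ?Q = "insert y (outer u y)"
  have yu: "y \<noteq> u" using u adj_irrefl by blast
  note side = mid_side[OF high_imp_mid[OF u(1)] u(2)]
  have us: "u \<notin> side u y" using adj_irrefl by (auto simp: side_def)
  have yo: "y \<notin> outer u y" using u by (auto simp: in_outer)
  have "adj u z \<and> adj z u" if "z \<in> side u y" for z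
    using that adj_commute[of u z] by (simp add: side_def)
  then have "clique ?P"
    using side(1) adj_in_V[OF u(2)] unfolding clique_def by blast
  moreover have "clique ?Q" using clique_outer[OF u(2)] .
  moreover have "?P \<union> ?Q = insert y (nbhd y)"
    using u(2) adj_sym[OF u(2)] by (auto simp: side_def in_outer)
  moreover have "?P \<inter> ?Q = {y}" using u yu by (auto simp: side_def in_outer)
  moreover have "card ?P = \<omega>"
    using side us omega_ge finite_clique[OF side(1)] by simp
  moreover have cQ: "card ?Q = Suc (card (outer u y))" using yo by simp
  moreover have "3 \<le> card ?Q"
    using cQ high_defect[OF u, of "{}"] omega_ge by simp
  moreover have "b = b'" if "a \<in> ?P - {y}" "b \<in> ?Q - {y}" "b' \<in> ?Q - {y}" "adj a b" "adj a b'" for a b b'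
  proof (rule ccontr)
    assume "b \<noteq> b'"
    have "a \<noteq> u" using that by (auto simp: in_outer)
    then have "adj u a" "adj y a" using that by (auto simp: side_def)
    then show False
      using high_no_double[OF u(1) u(2), of a b b'] that \<open>b \<noteq> b'\<close> by (auto simp: in_outer)
  qed
  moreover have "a = a'" if "b \<in> ?Q - {y}" "a \<in> ?P - {y}" "a' \<in> ?P - {y}" "adj a b" "adj a' b" for a a' b
  proof (rule ccontr)
    assume "a \<noteq> a'"
    have "a \<noteq> u" "a' \<noteq> u" using that by (auto simp: in_outer)
    then have "adj u a" "adj u a'" using that by (auto simp: side_def)
    then show False
      using high_no_triple[OF u(1) u(2), of a a' b] that \<open>a \<noteq> a'\<close> by (auto simp: in_outer)
  qed
  \<comment> \<open>If \<open>outer u y\<close> has at most 2 vertices, its defect is already at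
    least \<open>\<omega> - 3 \<ge> 2\<close>, and a cross edge would cost one more.\<close>
  moreover have "4 \<le> card ?Q \<or> (\<forall>a\<in>?P - {y}. \<forall>b\<in>?Q - {y}. \<not> adj a b)"
  proof (rule ccontr)
    assume "\<not> ?thesis"
    then obtain a b where ab: "a \<in> ?P - {y}" "b \<in> ?Q - {y}" "adj a b"
      and small: "card (outer u y) \<le> 2" using cQ by auto
    have "a \<noteq> u" using ab by (auto simp: in_outer)
    then have "adj u a" using ab by (auto simp: side_def)
    then have "2 \<le> card (common u b)"
      using ab u card_common_ge_2[of u y a b] by (auto simp: in_outer)
    moreover have "b \<in> second u" using ab u outer_sub_second by blast
    ultimately show False using high_defect[OF u, of "{b}"] small omega_ge by simp
  qed
  ultimately show ?thesis unfolding krausz_pair_def by (intro conjI ballI impI)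
qed

lemma krausz_pair_exists:
  assumes "y \<in> V"
  shows "\<exists>P Q. krausz_pair y P Q"
  using mid_or_high_nbr[OF assms] krausz_pair_mid[OF _ assms] krausz_pair_high_nbr adj_sym by blast

lemma krausz_pairD:
  assumes "krausz_pair y P Q"
  shows "clique P" "clique Q" "P \<union> Q = insert y (nbhd y)" "P \<inter> Q = {y}" "card P = \<omega>" "3 \<le> card Q"
  using assms unfolding krausz_pair_def by simp_all

lemma krausz_pair_matching:
  assumes "krausz_pair y P Q" "a \<in> P - {y}" "b \<in> Q - {y}" "adj a b"
  shows "\<lbrakk>b' \<in> Q - {y}; adj a b'\<rbrakk> \<Longrightarrow> b' = b" "\<lbrakk>a' \<in> P - {y}; adj a' b\<rbrakk> \<Longrightarrow> a' = a" "4 \<le> card Q"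
proof -
  note k = assms(1)[unfolded krausz_pair_def, THEN conjunct2, THEN conjunct2, THEN conjunct2,
      THEN conjunct2, THEN conjunct2, THEN conjunct2]
  show "b' = b" if "b' \<in> Q - {y}" "adj a b'"
    using k[THEN conjunct1] assms(2-4) that by blast
  show "a' = a" if "a' \<in> P - {y}" "adj a' b"
    using k[THEN conjunct2, THEN conjunct1] assms(2-4) that by blast
  show "4 \<le> card Q"
    using k[THEN conjunct2, THEN conjunct2] assms(2-4) by blast
qed

section \<open>Compatibility of the local splittings\<close>

text \<open>A clique meeting both sides properly contains a cross edge \<open>a b\<close> and a
  fourth vertex \<open>c\<close>; on either side \<open>c\<close> breaks the matching
  condition.\<close>

lemma krausz_pair_large_clique:
  assumes k: "krausz_pair y P Q" and C: "clique C" "y \<in> C" "4 \<le> card C"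
  shows "C \<subseteq> P \<or> C \<subseteq> Q"
proof (rule ccontr)
  assume "\<not> (C \<subseteq> P \<or> C \<subseteq> Q)"
  then obtain a b where ab: "a \<in> C" "a \<notin> Q" "b \<in> C" "b \<notin> P" by blast
  have "c = y \<or> adj y c" if "c \<in> C" for c
    using clique_adj[OF C(1,2) that] by auto
  then have "C \<subseteq> insert y (nbhd y)" by (simp add: subset_iff)
  then have sub: "C \<subseteq> P \<union> Q" using krausz_pairD(3)[OF k] by simp
  have yPQ: "y \<in> P" "y \<in> Q" using krausz_pairD(4)[OF k] by auto
  have "\<not> C \<subseteq> {y, a, b}"
  proof
    assume "C \<subseteq> {y, a, b}"
    then have "card C \<le> card {y, a, b}" by (intro card_mono) auto
    also have "\<dots> \<le> 3" by (simp add: card_insert_if)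
    finally show False using C(3) by simp
  qed
  then obtain c where c: "c \<in> C" "c \<noteq> y" "c \<noteq> a" "c \<noteq> b" by blast
  have PQ: "a \<in> P - {y}" "b \<in> Q - {y}" using ab sub yPQ by auto
  have "a \<noteq> b" using PQ ab(4) by auto
  then have adj: "adj a b" "adj a c" "adj c b"
    using clique_adj[OF C(1)] ab(1,3) c by simp_all
  have "c \<in> P - {y} \<or> c \<in> Q - {y}" using c sub by auto
  then show False
    using krausz_pair_matching(1)[OF k PQ adj(1) _ adj(2)]
      krausz_pair_matching(2)[OF k PQ adj(1) _ adj(3)] c(3,4) by auto
qed

text \<open>\<open>P\<close> has \<open>\<omega> \<ge> 5\<close> vertices, so it lies in one clique
  at \<open>z\<close>, and no clique properly contains it.\<close>

lemma krausz_pair_consistent_fst: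
  assumes "krausz_pair y P Q" "z \<in> P" "krausz_pair z P' Q'"
  shows "P = P' \<or> P = Q'"
proof -
  have P: "clique P" "card P = \<omega>" and P': "clique P'" "clique Q'"
    using krausz_pairD[OF assms(1)] krausz_pairD[OF assms(3)] by auto
  then have "P \<subseteq> P' \<or> P \<subseteq> Q'"
    using krausz_pair_large_clique[OF assms(3)] assms(2) omega_ge by simp
  moreover have "P = R" if "P \<subseteq> R" "clique R" for R
    using card_seteq[OF finite_clique[OF that(2)] that(1)] card_clique[OF that(2)] P(2) by simp
  ultimately show ?thesis using P' by blast
qed

text \<open>\<open>Q\<close> may be small, so its size no longer decides. The matching conditions
  show instead that \<open>Q\<close> lies in one clique at \<open>w\<close> and that
  \<open>Q\<close> is a maximal clique.\<close>

lemma krausz_pair_consistent_snd: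
  assumes k: "krausz_pair y P Q" and w: "w \<in> Q" and k': "krausz_pair w P' Q'"
  shows "Q = P' \<or> Q = Q'"
proof (cases "w = y")
  case True
  \<comment> \<open>At a single vertex each of the two cliques determines the other, so agreement of
    \<open>P\<close> carries over to \<open>Q\<close>.\<close>
  have compl: "Z = insert y (nbhd y - X)"
    if "X \<union> Z = insert y (nbhd y)" "X \<inter> Z = {y}" for X Z
  proof -
    have "Z = ((X \<union> Z) - X) \<union> (X \<inter> Z)" by blast
    also have "\<dots> = insert y (nbhd y - X)" unfolding that by blast
    finally show ?thesis .
  qed
  have "Q = insert y (nbhd y - P)" using compl krausz_pairD(3,4)[OF k] .
  moreover have "Q' = insert y (nbhd y - P')"
    using compl[of P' Q'] krausz_pairD(3,4)[OF k'] True by simp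
  moreover have "P' = insert y (nbhd y - Q')"
    using compl[of Q' P'] krausz_pairD(3,4)[OF k'] True by (simp add: Un_commute Int_commute)
  moreover have "y \<in> P" using krausz_pairD(4)[OF k] by auto
  then have "P = P' \<or> P = Q'"
    using krausz_pair_consistent_fst[OF k _ k'] True by simp
  ultimately show ?thesis by metis
next
  case False
  have Q: "clique Q" "3 \<le> card Q" "y \<in> Q" "P \<union> Q = insert y (nbhd y)" "P \<inter> Q = {y}"
    using krausz_pairD[OF k] by auto
  have yw: "adj y w" using Q(1,3) w False unfolding clique_def by simp
  have cover': "P' \<union> Q' = insert w (nbhd w)" "P' \<inter> Q' = {w}" "clique P'" "clique Q'"
    "3 \<le> card P'" "3 \<le> card Q'"
    using krausz_pairD[OF k'] omega_ge by auto
  have Qsub: "Q \<subseteq> P' \<or> Q \<subseteq> Q'"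
  proof (cases "4 \<le> card Q")
    case True
    then show ?thesis using krausz_pair_large_clique[OF k' Q(1) w] by blast
  next
    case False
    then have c3: "card Q = 3" using Q by simp
    have none: "\<And>a. a \<in> P - {y} \<Longrightarrow> \<not> adj a w"
      using krausz_pair_matching(3)[OF k] False w \<open>w \<noteq> y\<close> by blast
    have "card (Q - {y, w}) = 1"
      using c3 w Q(3) \<open>w \<noteq> y\<close> by (simp add: card_Diff_subset)
    then obtain w' where "Q - {y, w} = {w'}" by (auto simp: card_1_singleton_iff)
    then have Qeq: "Q = {y, w, w'}" "w' \<noteq> y" "w' \<noteq> w" using w Q(3) by auto
    \<comment> \<open>For a triple \<open>Q\<close> there are no cross edges at \<open>y\<close>, so
      \<open>w'\<close> is the only common neighbour of \<open>y\<close> and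
      \<open>w\<close>.\<close>
    have X: "Q \<subseteq> X" if X: "clique X" "3 \<le> card X" "w \<in> X" "y \<in> X" for X
    proof (rule ccontr)
      assume "\<not> Q \<subseteq> X"
      then have "w' \<notin> X" using Qeq X by auto
      have "\<not> X \<subseteq> {y, w}"
        using X(2) card_mono[of "{y, w}" X] \<open>w \<noteq> y\<close> by auto
      then obtain s where s: "s \<in> X" "s \<noteq> y" "s \<noteq> w" by blast
      then have "adj y s" "adj s w" using X unfolding clique_def by auto
      moreover have "s \<notin> Q" using s Qeq \<open>w' \<notin> X\<close> by auto
      ultimately show False using none[of s] Q(4) s by (auto simp flip: in_nbhd)
    qed
    have "y \<in> P' \<or> y \<in> Q'" "w \<in> P'" "w \<in> Q'"
      using cover'(1,2) adj_sym[OF yw] by (auto simp flip: in_nbhd)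
    then show ?thesis using X cover' by blast
  qed
  \<comment> \<open>A vertex extending \<open>Q\<close> would lie in \<open>P\<close> and be
    adjacent to two vertices of \<open>Q - {y}\<close>, against the matching.\<close>
  have "R \<subseteq> Q" if R: "clique R" "Q \<subseteq> R" for R
  proof
    fix t assume t: "t \<in> R"
    show "t \<in> Q"
    proof (rule ccontr)
      assume "t \<notin> Q"
      then have ta: "adj t q" if "q \<in> Q" for q
        using R(1) subsetD[OF R(2) that] t that unfolding clique_def by auto
      then have "t \<in> P - {y}" using Q(3,4) \<open>t \<notin> Q\<close> adj_sym[OF ta[OF Q(3)]] by (auto simp flip: in_nbhd)
      moreover have "card (Q - {y}) \<ge> 2" using Q by simp
      then obtain B where "B \<subseteq> Q - {y}" "card B = 2" by (meson obtain_subset_with_card_n)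
      then obtain b c where "b \<in> Q - {y}" "c \<in> Q - {y}" "b \<noteq> c" by (auto simp: card_2_iff)
      ultimately show False using krausz_pair_matching(1)[OF k] ta by blast
    qed
  qed
  then show ?thesis using Qsub cover' by blast
qed

text \<open>This is the clique partition of Krausz' criterion: the cliques become the vertices of
  the root graph, and \<open>x\<close> becomes the edge between \<open>p x\<close> and
  \<open>q x\<close>.\<close>

lemma krausz_cliques:
  obtains p q :: "'a \<Rightarrow> 'a set"
  where "\<And>x. x \<in> V \<Longrightarrow> p x \<inter> q x = {x}" "\<And>x. x \<in> V \<Longrightarrow> p x \<noteq> q x" "\<And>x. x \<in> V \<Longrightarrow> card (p x) = \<omega>"
    "\<And>c. c \<in> p ` V \<union> q ` V \<Longrightarrow> clique c"
    "\<And>x c. \<lbrakk>x \<in> V; c \<in> p ` V \<union> q ` V\<rbrakk> \<Longrightarrow> x \<in> c \<longleftrightarrow> c = p x \<or> c = q x"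
    "\<And>x y. adj x y \<Longrightarrow> y \<in> p x \<or> y \<in> q x"
proof -
  have "\<forall>y\<in>V. \<exists>PQ. krausz_pair y (fst PQ) (snd PQ)" using krausz_pair_exists by fastforce
  then obtain r where r: "\<forall>y\<in>V. krausz_pair y (fst (r y)) (snd (r y))" by (rule bchoice[THEN exE])
  define p where "p y = fst (r y)" for y
  define q where "q y = snd (r y)" for y
  have k: "krausz_pair y (p y) (q y)" if "y \<in> V" for y using r that by (simp add: p_def q_def)
  have pq: "p x \<inter> q x = {x}" if "x \<in> V" for x using krausz_pairD(4)[OF k[OF that]] .
  have ne: "p x \<noteq> q x" if "x \<in> V" for x
  proof
    assume "p x = q x"
    then have "q x = {x}" using pq[OF that] by simp
    then show False using krausz_pairD(6)[OF k[OF that]] by simp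
  qed
  have mem: "c = p x \<or> c = q x" if "x \<in> V" "c \<in> p ` V \<union> q ` V" "x \<in> c" for x c
    using that(2)
  proof
    assume "c \<in> p ` V"
    then obtain y where "y \<in> V" "c = p y" by blast
    then show ?thesis using krausz_pair_consistent_fst[OF k _ k] that by blast
  next
    assume "c \<in> q ` V"
    then obtain y where "y \<in> V" "c = q y" by blast
    then show ?thesis using krausz_pair_consistent_snd[OF k _ k] that by blast
  qed
  show ?thesis
  proof (rule that)
    show "p x \<inter> q x = {x}" "p x \<noteq> q x" "card (p x) = \<omega>" if "x \<in> V" for x
      using pq ne krausz_pairD(5)[OF k] that by auto
    show "clique c" if "c \<in> p ` V \<union> q ` V" for c
      using that krausz_pairD(1,2)[OF k] by blast
    show "x \<in> c \<longleftrightarrow> c = p x \<or> c = q x" if "x \<in> V" "c \<in> p ` V \<union> q ` V" for x c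
      using mem[OF that] pq[OF that(1)] by blast
    show "y \<in> p x \<or> y \<in> q x" if "adj x y" for x y
      using krausz_pairD(3)[OF k[OF adj_in_V[OF that]]] that by (auto simp flip: in_nbhd)
  qed
qed

end

section \<open>Line graphs and the translation to digraphs\<close>

text \<open>Each \<open>x\<close> becomes an edge with ends \<open>p x\<close> and
  \<open>q x\<close>. Hypothesis \<open>ne\<close> excludes loops, \<open>inj\<close> excludes
  parallel edges, and \<open>arc\<close> says that adjacency means sharing an end.\<close>

lemma line_graph_of_pairs:
  fixes G :: "'a pair_pre_digraph" and p q :: "'a \<Rightarrow> 'c"
  assumes G: "pair_graph G"
    and ne: "\<And>x. x \<in> pverts G \<Longrightarrow> p x \<noteq> q x"
    and inj: "\<And>x y. \<lbrakk>x \<in> pverts G; y \<in> pverts G; {p x, q x} = {p y, q y}\<rbrakk> \<Longrightarrow> x = y"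
    and arc: "\<And>x y. \<lbrakk>x \<in> pverts G; y \<in> pverts G; x \<noteq> y\<rbrakk>
      \<Longrightarrow> (x, y) \<in> parcs G \<longleftrightarrow> {p x, q x} \<inter> {p y, q y} \<noteq> {}"
  obtains F :: "nat pair_pre_digraph" and f
  where "pair_graph F" "pverts F = f ` (p ` pverts G \<union> q ` pverts G)"
    "\<And>c. c \<in> p ` pverts G \<union> q ` pverts G \<Longrightarrow>
      graph_degree F (f c) = card {x \<in> pverts G. c = p x \<or> c = q x}"
    "digraph_iso (with_proj G) (with_proj (line_graph F))"
proof -
  interpret pair_graph G by (rule G)
  let ?V = "pverts G"
  define C where "C = p ` ?V \<union> q ` ?V"
  have "finite C" using pair_finite_verts by (simp add: C_def)
  \<comment> \<open>The finitely many ends are renamed by natural numbers, since the root graph has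
    vertex type \<open>nat\<close>.\<close>
  then obtain f :: "'c \<Rightarrow> nat" where f: "inj_on f C"
    by (auto dest!: finite_imp_inj_to_nat_seg)
  have C: "p x \<in> C" "q x \<in> C" if "x \<in> ?V" for x using that by (auto simp: C_def)
  have f_eq: "f c = f d \<longleftrightarrow> c = d" if "c \<in> C" "d \<in> C" for c d
    by (rule inj_on_eq_iff[OF f that])
  define F where "F = \<lparr>pverts = f ` C,
    parcs = (\<lambda>x. (f (p x), f (q x))) ` ?V \<union> (\<lambda>x. (f (q x), f (p x))) ` ?V\<rparr>"
  define e where "e x = {f (p x), f (q x)}" for x
  have pq_F: "f (p x) \<noteq> f (q x)" if "x \<in> ?V" for x
    using that ne[OF that] f_eq[OF C[OF that]] by simp
  have F: "pair_graph F"
  proof unfold_locales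
    show "fst a \<in> pverts F" "snd a \<in> pverts F" if "a \<in> parcs F" for a
      using that C by (auto simp: F_def)
    show "finite (pverts F)" "finite (parcs F)"
      using \<open>finite C\<close> pair_finite_verts by (auto simp: F_def)
    show "fst a \<noteq> snd a" if "a \<in> parcs F" for a
      using that pq_F pq_F[symmetric] by (auto simp: F_def)
    show "symmetric (with_proj F)"
      by (auto simp: symmetric_def sym_def F_def)
  qed
  have e_img: "e x = f ` {p x, q x}" for x by (simp add: e_def)
  have inj_e: "inj_on e ?V"
  proof (rule inj_onI)
    fix x y assume xy: "x \<in> ?V" "y \<in> ?V" "e x = e y"
    then have "{p x, q x} = {p y, q y}"
      unfolding e_img using inj_on_image_eq_iff[OF f, of "{p x, q x}" "{p y, q y}"] C by auto
    then show "x = y" using inj xy by blast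
  qed
  have edges: "undirected_edges F = e ` ?V"
    unfolding undirected_edges_def F_def e_def by (auto simp: insert_commute)
  have meet: "e x \<inter> e y \<noteq> {} \<longleftrightarrow> {p x, q x} \<inter> {p y, q y} \<noteq> {}" if "x \<in> ?V" "y \<in> ?V" for x y
    unfolding e_img using inj_on_image_Int[OF f, of "{p x, q x}" "{p y, q y}"] C that
    by (auto simp flip: image_is_empty)
  have "digraph_iso (with_proj G) (with_proj (line_graph F))"
    unfolding digraph_iso_def
  proof (intro exI conjI)
    let ?h = "\<lparr>iso_verts = e, iso_arcs = map_prod e e, iso_head = snd, iso_tail = fst\<rparr>"
    have "inj_on (map_prod e e) (?V \<times> ?V)"
      using inj_e by (intro map_prod_inj_on)
    then have "inj_on (map_prod e e) (parcs G)"
      by (rule inj_on_subset) (auto dest: wellformed')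
    then show "pre_digraph.digraph_isomorphism (with_proj G) ?h"
      unfolding pre_digraph.digraph_isomorphism_def using inj_e wf_digraph by simp
    have "parcs (line_graph F) = map_prod e e ` parcs G"
    proof (intro equalityI subsetI)
      fix a assume "a \<in> parcs (line_graph F)"
      then obtain x y where a: "a = (e x, e y)" "x \<in> ?V" "y \<in> ?V" "e x \<noteq> e y" "e x \<inter> e y \<noteq> {}"
        by (auto simp: line_graph_def edges)
      then have "(x, y) \<in> parcs G" using arc[of x y] meet[of x y] by blast
      then show "a \<in> map_prod e e ` parcs G" using a(1) by force
    next
      fix a assume "a \<in> map_prod e e ` parcs G"
      then obtain x y where a: "a = (e x, e y)" "(x, y) \<in> parcs G" by auto
      then have xy: "x \<in> ?V" "y \<in> ?V" "x \<noteq> y" using wellformed' no_loops' by auto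
      then have "e x \<noteq> e y" "e x \<inter> e y \<noteq> {}"
        using inj_on_eq_iff[OF inj_e, of x y] a(2) arc[of x y] meet[of x y] by simp_all
      then show "a \<in> parcs (line_graph F)" using a xy by (auto simp: line_graph_def edges)
    qed
    then show "with_proj (line_graph F) = app_iso ?h (with_proj G)"
      by (simp add: with_proj_def app_iso_def line_graph_def edges)
  qed
  moreover have "graph_degree F (f c) = card {x \<in> ?V. c = p x \<or> c = q x}" if c: "c \<in> C" for c
  proof -
    let ?X = "{x \<in> ?V. c = p x \<or> c = q x}"
    \<comment> \<open>\<open>g\<close> sends \<open>x\<close> to its arc leaving \<open>f c\<close>,
      whose head is the other end of \<open>x\<close>.\<close>
    define g where "g x = (f c, f (if c = p x then q x else p x))" for x
    have "inj_on g ?X"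
    proof (rule inj_onI)
      fix x y assume xy: "x \<in> ?X" "y \<in> ?X" "g x = g y"
      then have "(if c = p x then q x else p x) = (if c = p y then q y else p y)"
        using C[of x] C[of y] by (auto simp: g_def f_eq split: if_splits)
      then have "{p x, q x} = {p y, q y}" using xy by (auto split: if_splits)
      then show "x = y" using inj xy by blast
    qed
    moreover have "g ` ?X = out_arcs (with_proj F) (f c)"
    proof (intro equalityI subsetI)
      fix a assume "a \<in> g ` ?X"
      then show "a \<in> out_arcs (with_proj F) (f c)" by (auto simp: g_def F_def)
    next
      fix a assume "a \<in> out_arcs (with_proj F) (f c)"
      then obtain x where x: "x \<in> ?V" "fst a = f c"
        "a = (f (p x), f (q x)) \<or> a = (f (q x), f (p x))"
        by (auto simp: F_def)
      then have "x \<in> ?X \<and> a = g x"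
        using f_eq[OF C(1)[OF x(1)] c] f_eq[OF C(2)[OF x(1)] c] ne[of x] by (auto simp: g_def)
      then show "a \<in> g ` ?X" by blast
    qed
    ultimately show ?thesis
      unfolding graph_degree_def out_degree_def using card_image by fastforce
  qed
  ultimately show ?thesis
    using that[of F f] F by (simp add: F_def C_def)
qed

section \<open>Distance, clique number and claws in terms of arcs\<close>

text \<open>With unit weights the cost of a walk is its length, so if no walk has length at most 2,
  the infimum is at least 3.\<close>

lemma graph_dist_le_2_iff:
  assumes "pair_graph G" "u \<in> pverts G" "v \<in> pverts G"
  shows "graph_dist G u v \<le> 2 \<longleftrightarrow>
    u = v \<or> (u, v) \<in> parcs G \<or> (\<exists>x. (u, x) \<in> parcs G \<and> (x, v) \<in> parcs G)"
proof -
  interpret pair_graph G by fact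
  have cost: "awalk_cost (\<lambda>_. 1) es = real (length es)" for es
    by (induction es) auto
  have dist: "graph_dist G u v = (INF es\<in>{es. awalk u es v}. ereal (length es))"
    unfolding graph_dist_def \<mu>_def cost ..
  show ?thesis
  proof
    assume le: "graph_dist G u v \<le> 2"
    have "\<exists>es. awalk u es v \<and> length es \<le> 2"
    proof (rule ccontr)
      assume "\<not> ?thesis"
      then have "3 \<le> length es" if "awalk u es v" for es using that by force
      then have "3 \<le> graph_dist G u v" unfolding dist by (intro INF_greatest) auto
      then have "(3 :: ereal) \<le> 2" using le by (rule order_trans)
      then show False by simp
    qed
    then obtain es where es: "awalk u es v" "length es \<le> 2" by blast
    \<comment> \<open>\<open>remdups_adj.cases\<close> serves only as a case split into lists of
      length 0, 1 and at least 2.\<close>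
    consider "es = []" | a where "es = [a]" | a b where "es = [a, b]"
      using es(2) by (cases es rule: remdups_adj.cases) auto
    then show "u = v \<or> (u, v) \<in> parcs G \<or> (\<exists>x. (u, x) \<in> parcs G \<and> (x, v) \<in> parcs G)"
      using es(1) by cases (auto simp: awalk_Cons_iff awalk_Nil_iff)
  next
    assume R: "u = v \<or> (u, v) \<in> parcs G \<or> (\<exists>x. (u, x) \<in> parcs G \<and> (x, v) \<in> parcs G)"
    have "\<exists>es. awalk u es v \<and> length es \<le> 2"
      using R
    proof (elim disjE exE conjE)
      assume "u = v"
      then show ?thesis using assms by (intro exI[of _ "[]"]) (simp add: awalk_Nil_iff)
    next
      assume "(u, v) \<in> parcs G"
      then show ?thesis using assms
        by (intro exI[of _ "[(u, v)]"]) (simp add: awalk_Nil_iff awalk_Cons_iff)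
    next
      fix x assume "(u, x) \<in> parcs G" "(x, v) \<in> parcs G"
      then show ?thesis using assms
        by (intro exI[of _ "[(u, x), (x, v)]"]) (simp add: awalk_Nil_iff awalk_Cons_iff)
    qed
    then obtain es where es: "awalk u es v" "length es \<le> 2" by blast
    then have "graph_dist G u v \<le> ereal (length es)" unfolding dist by (intro INF_lower) simp
    also have "\<dots> \<le> 2" using es(2) by simp
    finally show "graph_dist G u v \<le> 2" .
  qed
qed

text \<open>The set under \<open>Max\<close> is finite because the order of a complete subgraph is
  at most \<open>card (pverts G)\<close>.\<close>

lemma clique_le_clique_number:
  assumes "pair_graph G" "K \<subseteq> pverts G"
    and K: "\<And>x y. \<lbrakk>x \<in> K; y \<in> K; x \<noteq> y\<rbrakk> \<Longrightarrow> (x, y) \<in> parcs G"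
  shows "card K \<le> clique_number G"
proof -
  interpret pair_graph G by fact
  let ?S = "{n. \<exists>H. subgraph H (with_proj G) \<and> complete_digraph n H}"
  let ?H = "\<lparr>pverts = K, parcs = {(u, v). (u, v) \<in> K \<times> K \<and> u \<noteq> v}\<rparr>"
  have "finite K" using assms(2) pair_finite_verts finite_subset by blast
  then have "complete_digraph (card K) (with_proj ?H)"
    by (simp add: complete_digraph_pair_def)
  moreover from this have "wf_digraph (with_proj ?H)"
    unfolding complete_digraph_def using graph.axioms(1) digraph.axioms(1) fin_digraph.axioms(1) by blast
  then have "subgraph (with_proj ?H) (with_proj G)"
    using assms(2) K wf_digraph by (auto simp: subgraph_def compatible_def)
  ultimately have "card K \<in> ?S" by blast
  moreover have "?S \<subseteq> {..card (pverts G)}"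
    using pair_finite_verts by (auto simp: subgraph_def complete_digraph_def intro: card_mono)
  then have "finite ?S" using finite_subset by blast
  ultimately show ?thesis unfolding clique_number_def by (intro Max_ge)
qed

text \<open>If all three pairs were non-adjacent, the star with centre \<open>c\<close> would be
  exactly the subgraph induced on the four vertices.\<close>

lemma claw_free_adj:
  assumes "pair_graph G" "claw_free G"
    and "(c, x) \<in> parcs G" "(c, y) \<in> parcs G" "(c, z) \<in> parcs G" "x \<noteq> y" "y \<noteq> z" "x \<noteq> z"
  shows "(x, y) \<in> parcs G \<or> (y, z) \<in> parcs G \<or> (x, z) \<in> parcs G"
proof (rule ccontr)
  assume non: "\<not> ?thesis"
  interpret pair_graph G by fact
  let ?L = "{x, y, z}"
  let ?H = "\<lparr>pverts = {c} \<union> ?L, parcs = {c} \<times> ?L \<union> ?L \<times> {c}\<rparr>"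
  have cL: "c \<notin> ?L" and cL': "x \<noteq> c" "y \<noteq> c" "z \<noteq> c"
    using assms(3-5)[THEN no_loops'] by auto
  have arcs: "(x, c) \<in> parcs G" "(y, c) \<in> parcs G" "(z, c) \<in> parcs G"
    "(y, x) \<notin> parcs G" "(z, y) \<notin> parcs G" "(z, x) \<notin> parcs G"
    using assms(3-5)[THEN arcs_symmetric] non arcs_symmetric[of y x] arcs_symmetric[of z y]
      arcs_symmetric[of z x] by auto
  have verts: "{c} \<union> ?L \<subseteq> pverts G" using assms(3-5) wellformed' by auto
  have loops: "(u, u) \<notin> parcs G" for u using no_loops'[of u u] by auto
  have claw: "complete_bipartite_digraph 1 3 (with_proj ?H)"
    unfolding complete_bipartite_digraph_pair_def
    using cL assms(6-8) by (intro conjI exI[of _ "{c}"] exI[of _ ?L]) auto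
  have wf: "wf_digraph (with_proj ?H)"
    by (auto simp: wf_digraph_def)
  have H_arc: "(a, b) \<in> parcs ?H \<longleftrightarrow> (a, b) \<in> parcs G"
    if "a \<in> {c} \<union> ?L" "b \<in> {c} \<union> ?L" for a b
  proof -
    have "a = c \<or> a = x \<or> a = y \<or> a = z" "b = c \<or> b = x \<or> b = y \<or> b = z" using that by auto
    then show ?thesis
      by (elim disjE) (use assms(3-8) cL cL' arcs non loops in simp_all)
  qed
  have H_arcs: "parcs ?H = {e \<in> parcs G. fst e \<in> pverts ?H \<and> snd e \<in> pverts ?H}"
  proof (rule set_eqI)
    fix e :: "'a \<times> 'a"
    have "fst e \<in> pverts ?H \<and> snd e \<in> pverts ?H" if "e \<in> parcs ?H" using that by auto
    then show "e \<in> parcs ?H \<longleftrightarrow> e \<in> {e \<in> parcs G. fst e \<in> pverts ?H \<and> snd e \<in> pverts ?H}"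
      using H_arc[of "fst e" "snd e"] by auto
  qed
  have "parcs ?H \<subseteq> parcs G" unfolding H_arcs by auto
  then have "induced_subgraph (with_proj ?H) (with_proj G)"
    unfolding induced_subgraph_def subgraph_def compatible_def with_proj_simps
    using verts wf_digraph wf H_arcs by simp
  then show False using assms(2) claw unfolding claw_free_def by blast
qed

theorem theorem6p4:
  fixes G :: "'a pair_pre_digraph" and \<omega> :: nat
  assumes "pair_graph G"
    and "Digraph_Component.connected (with_proj G)"
    and "claw_free G"
    and "clique_number G = \<omega>"
    and "\<omega> \<ge> 5"
  shows "(\<exists>F :: nat pair_pre_digraph. pair_graph F \<and> max_degree F = \<omega> \<and>
            digraph_iso (with_proj G) (with_proj (line_graph F)))
       \<or> (\<exists>v \<in> pverts G.
            graph_degree (graph_square G) v \<le> 2 * \<omega> * (\<omega> - 1) - 4 \<and>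
            (\<forall>x \<in> open_neighbourhood G v.
               graph_degree (graph_square G) x \<le> 2 * \<omega> * (\<omega> - 1) - 3))"
proof (rule disjCI)
  assume not_ii: "\<not> (\<exists>v \<in> pverts G.
            graph_degree (graph_square G) v \<le> 2 * \<omega> * (\<omega> - 1) - 4 \<and>
            (\<forall>x \<in> open_neighbourhood G v.
               graph_degree (graph_square G) x \<le> 2 * \<omega> * (\<omega> - 1) - 3))"
  interpret pair_graph G by fact
  let ?V = "pverts G" and ?adj = "\<lambda>x y. (x, y) \<in> parcs G"
  interpret cf: claw_free_graph ?V ?adj \<omega>
  proof
    show "card K \<le> \<omega>" if "K \<subseteq> ?V" "\<And>x y. \<lbrakk>x \<in> K; y \<in> K; x \<noteq> y\<rbrakk> \<Longrightarrow> ?adj x y" for K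
      using clique_le_clique_number[OF assms(1) that] assms(4) by simp
    show "\<not> ?adj x x" for x using no_loops'[of x x] by auto
    show "?adj x y \<or> ?adj y z \<or> ?adj x z"
      if "?adj c x" "?adj c y" "?adj c z" "x \<noteq> y" "y \<noteq> z" "x \<noteq> z" for c x y z
      using claw_free_adj[OF assms(1,3) that] .
  qed (fact pair_finite_verts in_arcsD1 arcs_symmetric assms(5))+
  have deg: "graph_degree (graph_square G) v = cf.sqdeg v" if "v \<in> ?V" for v
  proof -
    have "b \<in> cf.nbhd v \<union> cf.second v \<longleftrightarrow> b \<in> ?V \<and> v \<noteq> b \<and> graph_dist G v b \<le> 2" for b
    proof (cases "b \<in> ?V")
      case True
      have "b \<in> cf.nbhd v \<union> cf.second v \<longleftrightarrow>
          v \<noteq> b \<and> (v = b \<or> ?adj v b \<or> (\<exists>x. ?adj v x \<and> ?adj x b))"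
        using cf.adj_irrefl[of v] by (auto simp: cf.second_def cf.outer_def)
      then show ?thesis using graph_dist_le_2_iff[OF assms(1) that True] True by simp
    next
      case False
      then have "\<not> ?adj x b" for x using in_arcsD2[of x b] by auto
      then show ?thesis using False by (simp add: cf.second_def cf.outer_def)
    qed
    then have eq: "cf.nbhd v \<union> cf.second v = {b \<in> ?V. v \<noteq> b \<and> graph_dist G v b \<le> 2}"
      by (simp add: set_eq_iff)
    have "out_arcs (with_proj (graph_square G)) v = Pair v ` (cf.nbhd v \<union> cf.second v)"
      unfolding eq using that by (auto simp: graph_square_def)
    then have "graph_degree (graph_square G) v = card (cf.nbhd v \<union> cf.second v)"
      unfolding graph_degree_def out_degree_def by (simp add: card_image inj_on_def)
    moreover have "cf.nbhd v \<inter> cf.second v = {}" by (auto simp: cf.second_def cf.outer_def)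
    ultimately show ?thesis by (simp add: cf.sqdeg_def card_Un_disjoint)
  qed
  \<comment> \<open>The assumption \<open>not_ii\<close> at \<open>y\<close> is exactly the density
    condition, translated by \<open>deg\<close>.\<close>
  interpret dense_claw_free_graph ?V ?adj \<omega>
  proof
    fix y assume y: "y \<in> ?V"
    show "cf.mid y \<or> (\<exists>u. ?adj y u \<and> cf.high u)"
    proof (rule disjCI)
      assume "\<not> (\<exists>u. ?adj y u \<and> cf.high u)"
      then have "graph_degree (graph_square G) x \<le> 2 * \<omega> * (\<omega> - 1) - 3"
        if "x \<in> open_neighbourhood G y" for x
        using that deg[of x] wellformed' by (force simp: open_neighbourhood_def cf.high_def)
      then have "\<not> graph_degree (graph_square G) y \<le> 2 * \<omega> * (\<omega> - 1) - 4"
        using not_ii y by blast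
      then show "cf.mid y" using deg[OF y] by (simp add: cf.mid_def)
    qed
  qed
  obtain p q :: "'a \<Rightarrow> 'a set" where
    pq: "\<And>x. x \<in> ?V \<Longrightarrow> p x \<inter> q x = {x}" and ne: "\<And>x. x \<in> ?V \<Longrightarrow> p x \<noteq> q x"
    and card_p: "\<And>x. x \<in> ?V \<Longrightarrow> card (p x) = \<omega>"
    and cl: "\<And>c. c \<in> p ` ?V \<union> q ` ?V \<Longrightarrow> cf.clique c"
    and mem: "\<And>x c. \<lbrakk>x \<in> ?V; c \<in> p ` ?V \<union> q ` ?V\<rbrakk> \<Longrightarrow> x \<in> c \<longleftrightarrow> c = p x \<or> c = q x"
    and adj: "\<And>x y. ?adj x y \<Longrightarrow> y \<in> p x \<or> y \<in> q x"
    using krausz_cliques by blast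
  \<comment> \<open>The two cliques of \<open>x\<close> meet in \<open>{x}\<close> alone, so they
    determine \<open>x\<close>.\<close>
  have inj: "x = y" if "x \<in> ?V" "y \<in> ?V" "{p x, q x} = {p y, q y}" for x y
  proof -
    have "p x \<inter> q x = p y \<inter> q y" using that(3) by (auto simp: doubleton_eq_iff)
    then show ?thesis using pq that by auto
  qed
  have arc: "?adj x y \<longleftrightarrow> {p x, q x} \<inter> {p y, q y} \<noteq> {}" if xy: "x \<in> ?V" "y \<in> ?V" "x \<noteq> y" for x y
  proof -
    have px: "p x \<in> p ` ?V \<union> q ` ?V" "q x \<in> p ` ?V \<union> q ` ?V" using xy by auto
    have "?adj x y \<longleftrightarrow> y \<in> p x \<or> y \<in> q x"
      using adj[of x y] cl[OF px(1)] cl[OF px(2)] pq[OF xy(1)] xy unfolding cf.clique_def by blast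
    also have "\<dots> \<longleftrightarrow> {p x, q x} \<inter> {p y, q y} \<noteq> {}"
      using mem[OF xy(2) px(1)] mem[OF xy(2) px(2)] by blast
    finally show ?thesis .
  qed
  obtain F :: "nat pair_pre_digraph" and f where
    F: "pair_graph F" and vF: "pverts F = f ` (p ` ?V \<union> q ` ?V)"
    and degF: "\<And>c. c \<in> p ` ?V \<union> q ` ?V \<Longrightarrow> graph_degree F (f c) = card {x \<in> ?V. c = p x \<or> c = q x}"
    and iso: "digraph_iso (with_proj G) (with_proj (line_graph F))"
    using line_graph_of_pairs[OF assms(1) ne inj arc] by blast
  \<comment> \<open>The edges of \<open>F\<close> at \<open>f c\<close> correspond to the members of
    \<open>c\<close>, so degrees are clique sizes: at most \<open>\<omega>\<close>, with
    \<open>\<omega>\<close> attained at every \<open>p x\<close>.\<close>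
  have degF': "graph_degree F (f c) = card c" if c: "c \<in> p ` ?V \<union> q ` ?V" for c
  proof -
    have "{x \<in> ?V. c = p x \<or> c = q x} = c"
      using mem[OF _ c] cl[OF c] unfolding cf.clique_def by blast
    then show ?thesis using degF[OF c] by simp
  qed
  \<comment> \<open>Connectedness includes nonemptiness, which supplies a vertex at which the
    maximum is attained.\<close>
  have "?V \<noteq> {}"
    using assms(2) by (auto simp: connected_def strongly_connected_def mk_symmetric_def)
  then obtain x where x: "x \<in> ?V" by blast
  have "max_degree F = \<omega>"
    unfolding max_degree_def
  proof (rule Max_eqI)
    show "finite (graph_degree F ` pverts F)"
      unfolding vF using pair_finite_verts by simp
    show "n \<le> \<omega>" if "n \<in> graph_degree F ` pverts F" for n
      using that degF' cf.card_clique[OF cl] unfolding vF by auto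
    show "\<omega> \<in> graph_degree F ` pverts F"
      unfolding vF using degF'[of "p x"] card_p[OF x] x by (metis UnI1 image_eqI)
  qed
  then show "\<exists>F :: nat pair_pre_digraph. pair_graph F \<and> max_degree F = \<omega> \<and>
            digraph_iso (with_proj G) (with_proj (line_graph F))"
    using F iso by blast
qed

end
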